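(* Let $n,r\ge 1$ be integers. Then $$h_n[p_r]=\sum_{w\in \mathrm{WCom}_r(nr)} \hat{s}_r(w)\,h_w .$$
   Context: $h_n$ is the $n$th complete homogeneous symmetric function in $x_1,x_2,\ldots$ over $\mathbb{Q}$ (with $h_0=1$), $p_r=\sum_i x_i^r$ is the power sum, and $h_n[p_r]$ denotes plethysm, i.e. $h_n[p_r](x_1,x_2,\ldots)=h_n(x_1^r,x_2^r,\ldots)$. $\mathrm{WCom}_r(m)$ is the set of $r$-weak compositions of $m$, i.e. $r$-tuples $w=(w_0,\ldots,w_{r-1})$ of non-negative integers with sum $m$. For such $w$, $h_w=h_{w_0}h_{w_1}\cdots h_{w_{r-1}}$. Let $\delta_r=(0,1,\ldots,r-1)$, and let $(w+\delta_r)\%r$ be the list whose $i$th entry ($0\le i\le r-1$) is the remainder of $w_i+i$ upon division by $r$. If the entries of $(w+\delta_r)\%r$ are distinct (so the list is a permutation of $0,1,\ldots,r-1$), then $\hat{s}_r(w)=(-1)^{\mathrm{inv}((w+\delta_r)\%r)}$, where $\mathrm{inv}(v)$ is the number of pairs $i<j$ with $v_i>v_j$. Otherwise $\hat{s}_r(w)=0$. *)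

theory Defs
  imports Complex_Main "HOL-Library.Poly_Mapping"
begin

text \<open>
  Formal power series in countably many commuting variables \<open>x\<^sub>0, x\<^sub>1, \<dots>\<close>.
  A monomial is its finitely supported exponent vector, an element of \<open>nat \<Rightarrow>\<^sub>0 nat\<close>,
  and a series is an arbitrary assignment of coefficients to monomials.
  Symmetric functions are the series of bounded degree that are invariant under
  permutations of the variables, with the operations inherited from this ring.
\<close>

typedef 'a series = "UNIV :: ((nat \<Rightarrow>\<^sub>0 nat) \<Rightarrow> 'a) set"
  morphisms coeff_at Abs_series
  by simp

setup_lifting type_definition_series

lemma series_eqI: "(\<And>m. coeff_at f m = coeff_at g m) \<Longrightarrow> f = g"
  by (simp add: coeff_at_inject[symmetric] fun_eq_iff)

lemma finite_splits: "finite {(a, b). a + b = (m :: nat \<Rightarrow>\<^sub>0 nat)}"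
proof -
  let ?K = "Poly_Mapping.keys m"
  let ?B = "{..(\<Sum>i\<in>?K. Poly_Mapping.lookup m i)}"
  let ?F = "{f. \<forall>x. (x \<in> ?K \<longrightarrow> f x \<in> ?B) \<and> (x \<notin> ?K \<longrightarrow> f x = 0)}"
  have "finite ?F"
    by (rule finite_set_of_finite_funs) auto
  moreover have "inj (Poly_Mapping.lookup :: (nat \<Rightarrow>\<^sub>0 nat) \<Rightarrow> _)"
    by (simp add: inj_def)
  ultimately have fin: "finite (Poly_Mapping.lookup -` ?F)"
    by (rule finite_vimageI)
  have le: "a \<in> Poly_Mapping.lookup -` ?F" if "a + b = m" for a b
  proof -
    have l: "Poly_Mapping.lookup a x \<le> Poly_Mapping.lookup m x" for x
      unfolding that[symmetric] by (simp add: Poly_Mapping.lookup_add)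
    have "Poly_Mapping.lookup a x \<in> ?B" if "x \<in> ?K" for x
      using l[of x] member_le_sum[OF that, of "Poly_Mapping.lookup m"] by simp
    moreover have "Poly_Mapping.lookup a x = 0" if "x \<notin> ?K" for x
      using l[of x] that by (simp add: Poly_Mapping.in_keys_iff)
    ultimately show ?thesis
      by blast
  qed
  have "{(a, b). a + b = m} \<subseteq> Poly_Mapping.lookup -` ?F \<times> Poly_Mapping.lookup -` ?F"
  proof (rule subsetI)
    fix p
    assume "p \<in> {(a, b). a + b = m}"
    then obtain a b where p: "p = (a, b)" "a + b = m"
      by blast
    moreover from p(2) have "b + a = m"
      by (simp add: add.commute)
    ultimately show "p \<in> Poly_Mapping.lookup -` ?F \<times> Poly_Mapping.lookup -` ?F"
      using le by blast
  qed
  then show ?thesis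
    by (rule finite_subset) (intro finite_cartesian_product fin)
qed

instantiation series :: (comm_ring_1) comm_ring_1
begin

lift_definition zero_series :: "'a series" is "\<lambda>_. 0" .
lift_definition one_series :: "'a series" is "\<lambda>m. if m = 0 then 1 else 0" .
lift_definition plus_series :: "'a series \<Rightarrow> 'a series \<Rightarrow> 'a series" is "\<lambda>f g m. f m + g m" .
lift_definition minus_series :: "'a series \<Rightarrow> 'a series \<Rightarrow> 'a series" is "\<lambda>f g m. f m - g m" .
lift_definition uminus_series :: "'a series \<Rightarrow> 'a series" is "\<lambda>f m. - f m" .
lift_definition times_series :: "'a series \<Rightarrow> 'a series \<Rightarrow> 'a series"
  is "\<lambda>f g m. \<Sum>(a, b) | a + b = m. f a * g b" .

instance
proof
  fix f g h :: "'a series"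
  show "f * g = g * f"
  proof (rule series_eqI, transfer)
    fix f g :: "(nat \<Rightarrow>\<^sub>0 nat) \<Rightarrow> 'a" and m
    show "(\<Sum>(a, b) | a + b = m. f a * g b) = (\<Sum>(a, b) | a + b = m. g a * f b)"
      by (rule sum.reindex_bij_witness[where i = "\<lambda>(a, b). (b, a)" and j = "\<lambda>(a, b). (b, a)"])
         (auto simp: add.commute mult.commute)
  qed
  show "f * g * h = f * (g * h)"
  proof (rule series_eqI, transfer)
    fix f g h :: "(nat \<Rightarrow>\<^sub>0 nat) \<Rightarrow> 'a" and m
    have "(\<Sum>(p, c) | p + c = m. (\<Sum>(a, b) | a + b = p. f a * g b) * h c)
        = (\<Sum>x\<in>{(p, c). p + c = m}. \<Sum>y\<in>{(a, b). a + b = fst x}. f (fst y) * g (snd y) * h (snd x))"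
      by (simp add: case_prod_unfold sum_distrib_right)
    also have "\<dots> = (\<Sum>(x, y)\<in>(SIGMA x:{(p, c). p + c = m}. {(a, b). a + b = fst x}).
        f (fst y) * g (snd y) * h (snd x))"
      by (rule sum.Sigma) (use finite_splits in auto)
    also have "\<dots> = (\<Sum>(x, y)\<in>(SIGMA x:{(a, q). a + q = m}. {(b, c). b + c = snd x}).
        f (fst x) * (g (fst y) * h (snd y)))"
      by (rule sum.reindex_bij_witness[
            where i = "\<lambda>((a, q), (b, c)). ((a + b, c), (a, b))"
              and j = "\<lambda>((p, c), (a, b)). ((a, b + c), (b, c))"]) (auto simp: add.assoc mult.assoc)
    also have "\<dots> = (\<Sum>x\<in>{(a, q). a + q = m}. \<Sum>y\<in>{(b, c). b + c = snd x}. f (fst x) * (g (fst y) * h (snd y)))"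
      by (rule sum.Sigma[symmetric]) (use finite_splits in auto)
    also have "\<dots> = (\<Sum>(a, q) | a + q = m. f a * (\<Sum>(b, c) | b + c = q. g b * h c))"
      by (simp add: case_prod_unfold sum_distrib_left)
    finally show "(\<Sum>(p, c) | p + c = m. (\<Sum>(a, b) | a + b = p. f a * g b) * h c)
        = (\<Sum>(a, q) | a + q = m. f a * (\<Sum>(b, c) | b + c = q. g b * h c))" .
  qed
  show "1 * f = f"
  proof (rule series_eqI, transfer)
    fix f :: "(nat \<Rightarrow>\<^sub>0 nat) \<Rightarrow> 'a" and m
    have "(\<Sum>(a, b) | a + b = m. (if a = 0 then 1 else 0) * f b)
        = (\<Sum>(a, b)\<in>{(0 :: nat \<Rightarrow>\<^sub>0 nat, m)}. (if a = 0 then 1 else 0) * f b)"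
      by (rule sum.mono_neutral_right) (use finite_splits in \<open>auto split: if_splits\<close>)
    then show "(\<Sum>(a, b) | a + b = m. (if a = 0 then 1 else 0) * f b) = f m"
      by simp
  qed
  show "(f + g) * h = f * h + g * h"
    by (rule series_eqI, transfer) (simp add: case_prod_unfold distrib_right sum.distrib)
  show "(0 :: 'a series) \<noteq> 1"
    by transfer (auto simp: fun_eq_iff)
  show "f + g + h = f + (g + h)" "f + g = g + f" "0 + f = f" "- f + f = 0" "f - g = f + - g"
    by (transfer, simp add: fun_eq_iff add_ac)+
qed

end

lemma coeff_at_0 [simp]: "coeff_at 0 m = 0"
  by (simp only: zero_series.rep_eq)

lemma coeff_at_1: "coeff_at 1 m = (if m = 0 then 1 else 0)"
  by (simp only: one_series.rep_eq)

lemma coeff_at_add [simp]: "coeff_at (f + g) m = coeff_at f m + coeff_at g m"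
  by (simp only: plus_series.rep_eq)

lemma coeff_at_mult: "coeff_at (f * g) m = (\<Sum>(a, b) | a + b = m. coeff_at f a * coeff_at g b)"
  by (simp only: times_series.rep_eq)

lift_definition var :: "nat \<Rightarrow> 'a::comm_ring_1 series"
  is "\<lambda>i m. if m = Poly_Mapping.single i 1 then 1 else 0" .

definition mdeg :: "(nat \<Rightarrow>\<^sub>0 nat) \<Rightarrow> nat" where
  "mdeg m = (\<Sum>i\<in>Poly_Mapping.keys m. Poly_Mapping.lookup m i)"

text \<open>The complete homogeneous symmetric function is the sum of all monomials of degree \<open>n\<close>.\<close>

lift_definition complete_hom :: "nat \<Rightarrow> rat series"
  is "\<lambda>n m. if mdeg m = n then 1 else 0" .

definition complete_hom_prod :: "nat list \<Rightarrow> rat series" where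
  "complete_hom_prod w = (\<Prod>k\<leftarrow>w. complete_hom k)"

text \<open>
  The plethysm \<open>f[p\<^sub>r](x\<^sub>0, x\<^sub>1, \<dots>) = f(x\<^sub>0\<^sup>r, x\<^sub>1\<^sup>r, \<dots>)\<close>: the coefficient of \<open>x\<^sup>e\<close> in \<open>f\<close>
  becomes the coefficient of \<open>x\<^bsup>r e\<^esup>\<close>, and all other coefficients vanish. The substitution
  is meaningful only for \<open>r \<ge> 1\<close>.
\<close>

lift_definition plethysm_power_sum :: "'a::comm_ring_1 series \<Rightarrow> nat \<Rightarrow> 'a series"
  is "\<lambda>f r m. if \<forall>i. r dvd Poly_Mapping.lookup m i then f (Poly_Mapping.map (\<lambda>e. e div r) m) else 0" .

lemma lookup_map_div: "Poly_Mapping.lookup (Poly_Mapping.map (\<lambda>e. e div r) m) i = Poly_Mapping.lookup m i div r"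
  for m :: "nat \<Rightarrow>\<^sub>0 nat"
  by (simp add: Poly_Mapping.map.rep_eq when_def)

lemma plethysm_power_sum_1: "r \<ge> 1 \<Longrightarrow> plethysm_power_sum 1 r = 1"
proof (rule series_eqI)
  fix m :: "nat \<Rightarrow>\<^sub>0 nat"
  assume "r \<ge> 1"
  have "(Poly_Mapping.map (\<lambda>e. e div r) m = 0) = (m = 0)" if "\<forall>i. r dvd Poly_Mapping.lookup m i"
    using that \<open>r \<ge> 1\<close> by (auto simp: poly_mapping_eq_iff fun_eq_iff lookup_map_div dvd_div_eq_0_iff)
  moreover have "\<forall>i. r dvd Poly_Mapping.lookup m i" if "m = 0"
    using that by simp
  ultimately show "coeff_at (plethysm_power_sum 1 r) m = coeff_at 1 m"
    by (auto simp: plethysm_power_sum.rep_eq coeff_at_1)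
qed

lemma plethysm_power_sum_add:
  "plethysm_power_sum (f + g) r = plethysm_power_sum f r + plethysm_power_sum g r"
  by (rule series_eqI) (simp add: plethysm_power_sum.rep_eq)

lemma plethysm_power_sum_mult:
  assumes "r \<ge> 1"
  shows "plethysm_power_sum (f * g) r = plethysm_power_sum f r * plethysm_power_sum g r"
proof (rule series_eqI)
  fix m :: "nat \<Rightarrow>\<^sub>0 nat"
  let ?d = "Poly_Mapping.map (\<lambda>e. e div r)"
  let ?u = "Poly_Mapping.map (\<lambda>e. r * e)"
  let ?D = "\<lambda>m. \<forall>i. r dvd Poly_Mapping.lookup m i"
  have u: "Poly_Mapping.lookup (?u a) i = r * Poly_Mapping.lookup a i" for a :: "nat \<Rightarrow>\<^sub>0 nat" and i
    by (simp add: Poly_Mapping.map.rep_eq when_def)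
  have ud: "?u (?d a) = a" if "?D a" for a :: "nat \<Rightarrow>\<^sub>0 nat"
    using that by (simp add: poly_mapping_eq_iff fun_eq_iff u lookup_map_div)
  have du: "?d (?u a) = a" for a :: "nat \<Rightarrow>\<^sub>0 nat"
    using assms by (simp add: poly_mapping_eq_iff fun_eq_iff u lookup_map_div)
  have Du: "?D (?u a)" for a :: "nat \<Rightarrow>\<^sub>0 nat"
    by (simp add: u)
  have uadd: "?u (a + b) = ?u a + ?u b" for a b :: "nat \<Rightarrow>\<^sub>0 nat"
    by (simp add: poly_mapping_eq_iff fun_eq_iff u Poly_Mapping.lookup_add distrib_left)
  have dadd: "?d (a + b) = ?d a + ?d b" if "?D a" "?D b" for a b :: "nat \<Rightarrow>\<^sub>0 nat"
    using that by (simp add: poly_mapping_eq_iff fun_eq_iff lookup_map_div Poly_Mapping.lookup_add)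
  let ?P = "\<lambda>a b. coeff_at (plethysm_power_sum f r) a * coeff_at (plethysm_power_sum g r) b"
  have R: "coeff_at (plethysm_power_sum f r * plethysm_power_sum g r) m
      = (\<Sum>(a, b)\<in>{(a, b). a + b = m \<and> ?D a \<and> ?D b}. ?P a b)"
    unfolding coeff_at_mult
    by (rule sum.mono_neutral_right) (use finite_splits in \<open>auto simp: plethysm_power_sum.rep_eq split: if_splits\<close>)
  show "coeff_at (plethysm_power_sum (f * g) r) m
      = coeff_at (plethysm_power_sum f r * plethysm_power_sum g r) m"
  proof (cases "?D m")
    case False
    then have E: "{(a, b). a + b = m \<and> ?D a \<and> ?D b} = {}"
      using dvd_add by (fastforce simp: Poly_Mapping.lookup_add)
    show ?thesis
      unfolding R E plethysm_power_sum.rep_eq using False by (simp only: if_False sum.empty)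
  next
    case True
    have "(\<Sum>(a, b)\<in>{(a, b). a + b = ?d m}. coeff_at f a * coeff_at g b)
        = (\<Sum>(a, b)\<in>{(a, b). a + b = m \<and> ?D a \<and> ?D b}. ?P a b)"
    proof (rule sum.reindex_bij_witness[where i = "\<lambda>(a, b). (?d a, ?d b)" and j = "\<lambda>(a, b). (?u a, ?u b)"], goal_cases)
      case (1 p)
      then show ?case by (auto simp: du)
    next
      case (2 p)
      then show ?case using ud[OF True] Du by (auto simp: uadd[symmetric] split_beta)
    next
      case (3 p)
      then show ?case using ud by (auto simp: split_beta)
    next
      case (4 p)
      then show ?case using dadd by (auto simp: split_beta)
    next
      case (5 p)
      then show ?case using Du du by (auto simp: split_beta plethysm_power_sum.rep_eq)
    qed
    then show ?thesis
      unfolding R using True by (simp add: plethysm_power_sum.rep_eq coeff_at_mult)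
  qed
qed

lemma plethysm_power_sum_var:
  assumes "r \<ge> 1"
  shows "plethysm_power_sum (var i :: 'a::comm_ring_1 series) r = var i ^ r"
proof -
  have pow: "coeff_at (var i ^ k :: 'a series) m = (if m = Poly_Mapping.single i k then 1 else 0)" for k m
  proof (induction k arbitrary: m)
    case 0
    show ?case by (simp add: coeff_at_1)
  next
    case (Suc k)
    let ?f = "\<lambda>(a, b). coeff_at (var i :: 'a series) a * coeff_at (var i ^ k :: 'a series) b"
    let ?p = "(Poly_Mapping.single i (1 :: nat), Poly_Mapping.single i k)"
    have s: "Poly_Mapping.single i 1 + Poly_Mapping.single i k = Poly_Mapping.single i (Suc k)"
      by (simp add: single_add[symmetric])
    have z: "?f x = 0" if "x \<noteq> ?p" for x
      using that by (cases x) (auto simp: Suc var.rep_eq)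
    have "(\<Sum>x\<in>{(a, b). a + b = m}. ?f x) = (\<Sum>x\<in>{(a, b). a + b = m} \<inter> {?p}. ?f x)"
      using z by (intro sum.mono_neutral_right) (use finite_splits in auto)
    also have "\<dots> = (if m = Poly_Mapping.single i (Suc k) then 1 else 0)"
    proof (cases "m = Poly_Mapping.single i (Suc k)")
      case True
      then have "{(a, b). a + b = m} \<inter> {?p} = {?p}"
        using s by auto
      then show ?thesis
        using True by (simp add: Suc var.rep_eq)
    next
      case False
      then have "{(a, b). a + b = m} \<inter> {?p} = {}"
        using s by auto
      then show ?thesis
        using False by simp
    qed
    finally show ?case
      by (simp add: coeff_at_mult)
  qed
  have "(\<forall>j. r dvd Poly_Mapping.lookup m j) \<and> Poly_Mapping.map (\<lambda>e. e div r) m = Poly_Mapping.single i 1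
      \<longleftrightarrow> m = Poly_Mapping.single i r" for m :: "nat \<Rightarrow>\<^sub>0 nat"
  proof
    assume A: "(\<forall>j. r dvd Poly_Mapping.lookup m j) \<and> Poly_Mapping.map (\<lambda>e. e div r) m = Poly_Mapping.single i 1"
    show "m = Poly_Mapping.single i r"
    proof (rule poly_mapping_eqI)
      fix j
      have "Poly_Mapping.lookup m j = Poly_Mapping.lookup m j div r * r"
        using A by simp
      also have "Poly_Mapping.lookup m j div r = Poly_Mapping.lookup (Poly_Mapping.single i 1) j"
        using A lookup_map_div[of r m j] by simp
      finally show "Poly_Mapping.lookup m j = Poly_Mapping.lookup (Poly_Mapping.single i r) j"
        by (simp add: lookup_single when_def split: if_splits)
    qed
  next
    assume "m = Poly_Mapping.single i r"
    then show "(\<forall>j. r dvd Poly_Mapping.lookup m j) \<and> Poly_Mapping.map (\<lambda>e. e div r) m = Poly_Mapping.single i 1"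
      using assms by (auto intro!: poly_mapping_eqI simp: lookup_map_div lookup_single when_def)
  qed
  note single = this
  show ?thesis
  proof (rule series_eqI)
    fix m
    show "coeff_at (plethysm_power_sum (var i :: 'a series) r) m = coeff_at (var i ^ r) m"
      unfolding pow plethysm_power_sum.rep_eq var.rep_eq single[symmetric] by simp
  qed
qed

definition WCom :: "nat \<Rightarrow> nat \<Rightarrow> nat list set" where
  "WCom r m = {w. length w = r \<and> sum_list w = m}"

lemma finite_WCom: "finite (WCom r m)"
proof (rule finite_subset)
  show "WCom r m \<subseteq> {w. set w \<subseteq> {..m} \<and> length w = r}"
    by (auto simp: WCom_def dest: member_le_sum_list)
  show "finite {w. set w \<subseteq> {..m} \<and> length w = r}"
    by (rule finite_lists_length_eq) simp
qed

definition inv_count :: "nat list \<Rightarrow> nat" where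
  "inv_count v = card {(i, j). i < j \<and> j < length v \<and> v ! i > v ! j}"

definition shifted_residues :: "nat \<Rightarrow> nat list \<Rightarrow> nat list" where
  "shifted_residues r w = map (\<lambda>i. (w ! i + i) mod r) [0..<r]"

definition s_hat :: "nat \<Rightarrow> nat list \<Rightarrow> int" where
  "s_hat r w =
     (if distinct (shifted_residues r w) then (-1) ^ inv_count (shifted_residues r w) else 0)"

end

theory Submission
  imports Defs "HOL-Combinatorics.Transposition"
begin

text \<open>
  The coefficient of \<open>x\<^sup>m\<close> on the right-hand side is the sum, over all ways of writing \<open>m\<close> as
  \<open>a\<^sub>0 + \<dots> + a\<^bsub>r-1\<^esub>\<close>, of the sign of the residues of \<open>\<bar>a\<^sub>i\<bar> + i\<close>. Distributing the
  exponent \<open>e\<close> of one variable replaces the vector \<open>u\<close> whose residues are considered by \<open>u + c\<close>, with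
  \<open>c\<close> running over the weak compositions of \<open>e\<close>. A sign-reversing involution shows that this
  multiplies the sign of \<open>u\<close> by 1 if \<open>r\<close> divides \<open>e\<close> and by 0 otherwise. Treating the variables
  one at a time yields 1 if \<open>r\<close> divides every exponent and 0 otherwise.
\<close>

section \<open>The sign of a residue vector\<close>

definition pairs_below :: "nat \<Rightarrow> (nat \<times> nat) set" where
  "pairs_below r = {(i, j). i < j \<and> j < r}"

lemma finite_pairs_below [simp]: "finite (pairs_below r)"
  by (rule finite_subset[of _ "{..<r} \<times> {..<r}"]) (auto simp: pairs_below_def)

text \<open>For values distinct on the indices below \<open>r\<close> this is -1 to the number of
  inversions. A repeated value yields a factor \<open>sgn 0\<close>, so the zero case of
  \<open>s_hat\<close> is built into the product.\<close>

definition order_sign :: "nat \<Rightarrow> (nat \<Rightarrow> int) \<Rightarrow> int" where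
  "order_sign r f = (\<Prod>(i, j)\<in>pairs_below r. sgn (f j - f i))"

lemma order_sign_cong:
  assumes "\<And>i. i < r \<Longrightarrow> f i = g i"
  shows "order_sign r f = order_sign r g"
  unfolding order_sign_def by (rule prod.cong) (use assms in \<open>auto simp: pairs_below_def\<close>)

lemma order_sign_eq_0:
  assumes "p < r" "q < r" "p \<noteq> q" "f p = f q"
  shows "order_sign r f = 0"
  unfolding order_sign_def
proof (rule prod_zero[OF finite_pairs_below])
  have "(min p q, max p q) \<in> pairs_below r"
    using assms by (auto simp: pairs_below_def)
  moreover have "f (max p q) = f (min p q)"
    using assms by (simp add: min_def max_def)
  ultimately show "\<exists>a\<in>pairs_below r. (case a of (i, j) \<Rightarrow> sgn (f j - f i)) = 0"
    by (intro bexI[of _ "(min p q, max p q)"]) auto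
qed

text \<open>An adjacent transposition permutes the ordered pairs other than
  \<open>(k, Suc k)\<close> among themselves and negates the factor of that one pair.\<close>

lemma order_sign_adjacent_transpose:
  assumes "Suc k < r"
  shows "order_sign r (f \<circ> transpose k (Suc k)) = - order_sign r f"
proof -
  let ?t = "transpose k (Suc k)"
  let ?D = "pairs_below r - {(k, Suc k)}"
  have k: "(k, Suc k) \<in> pairs_below r"
    using assms by (auto simp: pairs_below_def)
  have maps: "(?t i, ?t j) \<in> ?D" if "(i, j) \<in> ?D" for i j
    using that assms by (auto simp: pairs_below_def transpose_def)
  have "(\<Prod>(i, j)\<in>?D. sgn (f (?t j) - f (?t i))) = (\<Prod>(i, j)\<in>?D. sgn (f j - f i))"
    by (rule prod.reindex_bij_witness[where i = "\<lambda>(i, j). (?t i, ?t j)" and j = "\<lambda>(i, j). (?t i, ?t j)"])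
      (use maps in auto)
  then show ?thesis
    unfolding order_sign_def
    by (simp add: prod.remove[OF finite_pairs_below k] sgn_if)
qed

lemma order_sign_transpose_less:
  "p < q \<Longrightarrow> q < r \<Longrightarrow> order_sign r (f \<circ> transpose p q) = - order_sign r f"
proof (induction "q - p" arbitrary: p f)
  case 0
  then show ?case by simp
next
  case (Suc d)
  show ?case
  proof (cases "q = Suc p")
    case True
    then show ?thesis
      using order_sign_adjacent_transpose Suc.prems by simp
  next
    case False
    let ?a = "transpose p (Suc p)" and ?b = "transpose (Suc p) q"
    \<comment> \<open>Conjugating by an adjacent transposition shortens the distance by one; the
      three transpositions together contribute the sign (-1)^3.\<close>
    have *: "f \<circ> transpose p q = f \<circ> ?a \<circ> ?b \<circ> ?a"
      using False Suc.prems by (auto simp: fun_eq_iff transpose_def)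
    have b: "order_sign r (g \<circ> ?b) = - order_sign r g" for g
      using Suc False by (intro Suc.hyps(1)) auto
    have a: "order_sign r (g \<circ> ?a) = - order_sign r g" for g
      using Suc.prems by (intro order_sign_adjacent_transpose) auto
    show ?thesis
      unfolding * a b by simp
  qed
qed

lemma order_sign_transpose:
  assumes "p < r" "q < r" "p \<noteq> q"
  shows "order_sign r (f \<circ> transpose p q) = - order_sign r f"
  using assms order_sign_transpose_less[of p q r f] order_sign_transpose_less[of q p r f]
  by (cases "p < q") (auto simp: transpose_commute)

text \<open>Takes an arbitrary vector rather than a shifted composition, because the starting vector
  changes as the variables are treated one at a time.\<close>

definition res_sign :: "nat \<Rightarrow> (nat \<Rightarrow> nat) \<Rightarrow> int" where
  "res_sign r u = order_sign r (\<lambda>i. int (u i mod r))"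

lemma res_sign_cong:
  assumes "\<And>i. i < r \<Longrightarrow> u i mod r = v i mod r"
  shows "res_sign r u = res_sign r v"
  unfolding res_sign_def by (rule order_sign_cong) (simp add: assms)

lemma res_sign_eq_0:
  assumes "p < r" "q < r" "p \<noteq> q" "u p mod r = u q mod r"
  shows "res_sign r u = 0"
  unfolding res_sign_def by (rule order_sign_eq_0[OF assms(1-3)]) (simp add: assms(4))

text \<open>Only residues are compared, so that exchanging steps between two particles with merely
  congruent starting points still counts as a swap.\<close>

lemma res_sign_swap:
  assumes "p < r" "q < r" "p \<noteq> q"
    and "v p mod r = u q mod r" "v q mod r = u p mod r"
    and "\<And>i. i < r \<Longrightarrow> i \<noteq> p \<Longrightarrow> i \<noteq> q \<Longrightarrow> v i mod r = u i mod r"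
  shows "res_sign r v = - res_sign r u"
  unfolding res_sign_def order_sign_transpose[OF assms(1-3), symmetric]
  by (rule order_sign_cong) (use assms in \<open>auto simp: transpose_def\<close>)

lemma res_sign_id: "res_sign r (\<lambda>i. i) = 1"
  unfolding res_sign_def order_sign_def
  by (rule prod.neutral) (auto simp: pairs_below_def)

text \<open>Each inversion contributes a factor -1 to the product of signs, and a repeated residue
  makes the product vanish.\<close>

lemma s_hat_eq_res_sign: "s_hat r w = res_sign r (\<lambda>i. w ! i + i)"
proof (cases "distinct (shifted_residues r w)")
  case False
  then obtain p q where "p < r" "q < r" "p \<noteq> q" "(w ! p + p) mod r = (w ! q + q) mod r"
    by (auto simp: shifted_residues_def distinct_conv_nth)
  then show ?thesis
    using False by (simp add: s_hat_def res_sign_eq_0)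
next
  case True
  let ?f = "\<lambda>i. (w ! i + i) mod r"
  have ne: "?f i \<noteq> ?f j" if "(i, j) \<in> pairs_below r" for i j
    using True that by (auto simp: shifted_residues_def distinct_conv_nth pairs_below_def)
  have "res_sign r (\<lambda>i. w ! i + i) = (\<Prod>(i, j)\<in>pairs_below r. if ?f i > ?f j then - 1 else 1)"
    unfolding res_sign_def order_sign_def using ne
    by (intro prod.cong) (auto simp: sgn_if, force)
  also have "\<dots> = (-1) ^ card {x \<in> pairs_below r. ?f (fst x) > ?f (snd x)}"
    by (simp add: case_prod_unfold prod.If_cases Int_def)
  also have "{x \<in> pairs_below r. ?f (fst x) > ?f (snd x)} =
      {(i, j). i < j \<and> j < length (shifted_residues r w) \<and>
        shifted_residues r w ! i > shifted_residues r w ! j}"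
    by (auto simp: pairs_below_def shifted_residues_def)
  finally show ?thesis
    using True by (simp add: s_hat_def inv_count_def)
qed

section \<open>Summation over weak compositions\<close>

text \<open>Reindexing by \<open>\<phi>\<close> turns the sum into its own negative. Fixed points
  may occur, since \<open>F\<close> vanishes there.\<close>

lemma sum_sign_reversing_involution:
  fixes F :: "'a \<Rightarrow> int"
  assumes "\<And>x. x \<in> A \<Longrightarrow> \<phi> x \<in> A" "\<And>x. x \<in> A \<Longrightarrow> \<phi> (\<phi> x) = x" "\<And>x. x \<in> A \<Longrightarrow> F (\<phi> x) = - F x"
  shows "sum F A = 0"
proof -
  have "sum F A = (\<Sum>x\<in>A. - F x)"
    by (rule sum.reindex_bij_witness[where i = \<phi> and j = \<phi>]) (use assms in auto)
  then show ?thesis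
    by (simp add: sum_negf)
qed

lemma sum_list_update2:
  fixes c :: "nat list"
  assumes "p < length c" "q < length c" "p \<noteq> q" "x + y = c ! p + c ! q"
  shows "sum_list (c[p := x, q := y]) = sum_list c"
proof -
  \<comment> \<open>This bound makes the truncated subtractions in \<open>sum_list_update\<close>
    exact.\<close>
  have "c ! p + c ! q \<le> sum_list c"
  proof -
    have "c ! p + c ! q = (\<Sum>i\<in>{p, q}. c ! i)"
      using assms by simp
    also have "\<dots> \<le> (\<Sum>i\<in>{0..<length c}. c ! i)"
      using assms by (intro sum_mono2) auto
    finally show ?thesis
      by (simp add: sum_list_sum_nth)
  qed
  then show ?thesis
    using assms by (simp add: sum_list_update)
qed

text \<open>Two particles start at the same residue, so exchanging their step counts swaps their
  endpoints modulo \<open>r\<close> and reverses the sign.\<close>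

lemma sum_WCom_res_sign_collision:
  assumes "p < r" "q < r" "p \<noteq> q" "u p mod r = u q mod r"
  shows "(\<Sum>c\<in>WCom r e. res_sign r (\<lambda>i. u i + c ! i)) = 0"
proof (rule sum_sign_reversing_involution[where \<phi> = "\<lambda>c. c[p := c ! q, q := c ! p]"])
  fix c assume "c \<in> WCom r e"
  then have c: "length c = r" "sum_list c = e"
    by (auto simp: WCom_def)
  show "c[p := c ! q, q := c ! p] \<in> WCom r e"
    using c assms by (simp add: WCom_def sum_list_update2)
  show "(c[p := c ! q, q := c ! p])[p := c[p := c ! q, q := c ! p] ! q, q := c[p := c ! q, q := c ! p] ! p] = c"
    using c assms by (auto simp: list_eq_iff_nth_eq nth_list_update)
  show "res_sign r (\<lambda>i. u i + c[p := c ! q, q := c ! p] ! i) = - res_sign r (\<lambda>i. u i + c ! i)"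
    using c assms
    by (intro res_sign_swap[of p r q]) (auto simp: nth_list_update intro: mod_add_cong)
qed

text \<open>
  View \<open>u i + c ! i\<close> as the endpoint of a particle that starts at \<open>u i\<close> and moves \<open>c ! i\<close> steps
  around a cycle of length \<open>r\<close>. If the particle at \<open>k\<close> takes a first step, it meets the one at
  \<open>k + 1\<close>; exchanging their remaining steps reverses the sign. So the particles
  at \<open>0, 1, \<dots>, r - 2\<close> can successively be frozen.
\<close>

lemma sum_WCom_res_sign_freeze:
  assumes pos: "\<And>k. k < r \<Longrightarrow> pos k < r \<and> u (pos k) = k"
    and k: "k < r"
  shows "(\<Sum>c | c \<in> WCom r e \<and> (\<forall>l<k. c ! pos l = 0). res_sign r (\<lambda>i. u i + c ! i))
    = (\<Sum>c\<in>WCom r e. res_sign r (\<lambda>i. u i + c ! i))"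
  using k
proof (induction k)
  case 0
  then show ?case by simp
next
  case (Suc k)
  let ?A = "\<lambda>k. {c. c \<in> WCom r e \<and> (\<forall>l<k. c ! pos l = 0)}"
  let ?B = "{c \<in> ?A k. c ! pos k \<noteq> 0}"
  let ?F = "\<lambda>c. res_sign r (\<lambda>i. u i + c ! i)"
  let ?p = "pos k" and ?q = "pos (Suc k)"
  have pq: "?p < r" "?q < r" "?p \<noteq> ?q" "u ?p = k" "u ?q = Suc k"
    using pos[of k] pos[of "Suc k"] Suc.prems by auto
  have pl: "pos l \<noteq> ?p" "pos l \<noteq> ?q" if "l < k" for l
    using pos[of l] that Suc.prems pq by auto
  have "sum ?F ?B = 0"
  \<comment> \<open>The particle \<open>?p\<close> keeps its first step, from \<open>k\<close> to
    \<open>Suc k\<close>, and exchanges the \<open>c ! ?p - 1\<close> steps after it for all steps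
    of \<open>?q\<close>. The \<open>Suc\<close> keeps the entry at \<open>?p\<close> nonzero, so
    the image stays in \<open>?B\<close>.\<close>
  proof (rule sum_sign_reversing_involution[where \<phi> = "\<lambda>c. c[?p := Suc (c ! ?q), ?q := c ! ?p - 1]"])
    fix c assume "c \<in> ?B"
    then have c: "length c = r" "sum_list c = e" "\<And>l. l < k \<Longrightarrow> c ! pos l = 0" "c ! ?p > 0"
      by (auto simp: WCom_def)
    let ?c = "c[?p := Suc (c ! ?q), ?q := c ! ?p - 1]"
    have "?c ! pos l = 0" if "l < k" for l
      using c(3)[OF that] pl[OF that] by simp
    then show "?c \<in> ?B"
      using c pq by (simp add: WCom_def sum_list_update2 nth_list_update)
    show "?c[?p := Suc (?c ! ?q), ?q := ?c ! ?p - 1] = c"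
      using c pq by (auto simp: list_eq_iff_nth_eq nth_list_update)
    show "?F ?c = - ?F c"
      using c pq by (intro res_sign_swap[of ?p r ?q]) (auto simp: nth_list_update)
  qed
  moreover have "sum ?F (?A k) = sum ?F (?A (Suc k)) + sum ?F ?B"
  proof -
    have A: "?A k = ?A (Suc k) \<union> ?B"
      by (auto simp: less_Suc_eq)
    show ?thesis
      by (subst A, rule sum.union_disjoint) (use finite_WCom[of r e] in auto)
  qed
  ultimately show ?case
    using Suc by simp
qed

text \<open>Colliding starts cancel. Otherwise all particles but the one at residue
  \<open>r - 1\<close> are frozen, which leaves a single composition: that particle moves
  \<open>e\<close> steps. It returns to its start if \<open>r\<close> divides \<open>e\<close> and
  otherwise lands on a frozen particle.\<close>

lemma sum_WCom_res_sign:
  assumes "r \<ge> 1"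
  shows "(\<Sum>c\<in>WCom r e. res_sign r (\<lambda>i. u i + c ! i)) = (if r dvd e then res_sign r u else 0)"
proof (cases "inj_on (\<lambda>i. u i mod r) {..<r}")
  case False
  then obtain p q where pq: "p < r" "q < r" "p \<noteq> q" "u p mod r = u q mod r"
    by (auto simp: inj_on_def)
  show ?thesis
    using sum_WCom_res_sign_collision[OF pq] res_sign_eq_0[OF pq] by simp
next
  case True
  \<comment> \<open>Reduction modulo \<open>r\<close> preserves the sign and turns \<open>u\<close>
    into a permutation of the residues; its inverse \<open>pos\<close> is what the freezing lemma
    requires.\<close>
  let ?v = "\<lambda>i. u i mod r"
  have "?v ` {..<r} = {..<r}"
    using assms True by (intro card_subset_eq) (auto simp: card_image)
  then have "\<forall>k\<in>{..<r}. \<exists>i\<in>{..<r}. ?v i = k"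
    by (metis (no_types, lifting) imageE)
  then obtain pos where pos: "\<And>k. k < r \<Longrightarrow> pos k < r \<and> ?v (pos k) = k"
    by (metis lessThan_iff)
  let ?q = "pos (r - 1)"
  have q: "?q < r" "?v ?q = r - 1"
    using pos[of "r - 1"] assms by auto
  let ?c = "(replicate r 0)[?q := e]"
  \<comment> \<open>Every index except \<open>?q\<close> carries a frozen particle, so
    \<open>?c\<close> is the only remaining composition.\<close>
  have cov: "\<exists>l<r - 1. i = pos l" if "i < r" "i \<noteq> ?q" for i
  proof -
    have vi: "?v i < r"
      using assms by simp
    have *: "pos (?v i) = i"
      by (rule inj_onD[OF True]) (use pos[OF vi] that in auto)
    moreover have "?v i \<noteq> r - 1"
      using * that by auto
    ultimately show ?thesis
      using vi by (intro exI[of _ "?v i"]) auto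
  qed
  have "{c. c \<in> WCom r e \<and> (\<forall>l<r - 1. c ! pos l = 0)} = {?c}" (is "?L = _")
  proof (intro equalityI subsetI)
    fix c assume "c \<in> ?L"
    then have c: "length c = r" "sum_list c = e" "\<And>l. l < r - 1 \<Longrightarrow> c ! pos l = 0"
      by (auto simp: WCom_def)
    have z: "c ! i = 0" if "i < r" "i \<noteq> ?q" for i
      using cov[OF that] c(3) by auto
    have "e = (\<Sum>i\<in>{0..<r}. c ! i)"
      using c by (simp add: sum_list_sum_nth)
    also have "\<dots> = (\<Sum>i\<in>{?q}. c ! i)"
      using q z by (intro sum.mono_neutral_right) auto
    finally have "c ! ?q = e"
      by simp
    then have "c ! i = ?c ! i" if "i < r" for i
      using z[OF that] q that by (cases "i = ?q") auto
    then show "c \<in> {?c}"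
      using c by (simp add: list_eq_iff_nth_eq)
  next
    fix c assume "c \<in> {?c}"
    have ne: "?q \<noteq> pos l" "pos l < r" if "l < r - 1" for l
    proof -
      have "l < r"
        using that by simp
      from pos[OF this] show "?q \<noteq> pos l" "pos l < r"
        using q(2) that by auto
    qed
    have "?c ! pos l = 0" if "l < r - 1" for l
      by (simp only: nth_list_update_neq[OF ne(1)[OF that]] List.nth_replicate[OF ne(2)[OF that]])
    moreover have "?c \<in> WCom r e"
      using q by (simp add: WCom_def sum_list_update)
    ultimately show "c \<in> ?L"
      using \<open>c \<in> {?c}\<close> by simp
  qed
  then have "(\<Sum>c\<in>WCom r e. res_sign r (\<lambda>i. ?v i + c ! i)) = res_sign r (\<lambda>i. ?v i + ?c ! i)"
    using sum_WCom_res_sign_freeze[of r pos ?v "r - 1" e] pos assms by simp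
  moreover have "res_sign r (\<lambda>i. ?v i + c ! i) = res_sign r (\<lambda>i. u i + c ! i)" for c
    by (rule res_sign_cong) (simp add: mod_add_left_eq)
  ultimately have S: "(\<Sum>c\<in>WCom r e. res_sign r (\<lambda>i. u i + c ! i)) = res_sign r (\<lambda>i. ?v i + ?c ! i)"
    by simp
  show ?thesis
  proof (cases "r dvd e")
    case True
    then have "res_sign r (\<lambda>i. ?v i + ?c ! i) = res_sign r u"
      using q(1) by (intro res_sign_cong) (auto simp: nth_list_update)
    then show ?thesis
      using S True by simp
  next
    case False
    obtain l where l: "l = (r - 1 + e) mod r"
      by blast
    have "l \<noteq> r - 1"
    proof
      assume "l = r - 1"
      then have "(r - 1 + e) mod r = (r - 1) mod r"
        unfolding l[symmetric] using assms by simp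
      then have "r dvd (r - 1 + e) - (r - 1)"
        by (metis mod_eq_dvd_iff_nat le_add1)
      then show False
        using False by simp
    qed
    moreover have "l < r"
      unfolding l using assms by simp
    ultimately have p: "pos l < r" "?v (pos l) = l" "pos l \<noteq> ?q"
      using pos[OF \<open>l < r\<close>] q by auto
    have "?c ! pos l = 0" "?c ! ?q = e"
      using p(1) q(1) p(3)[symmetric] by simp_all
    then have "(?v (pos l) + ?c ! pos l) mod r = (?v ?q + ?c ! ?q) mod r"
      unfolding p(2) q(2) using l by simp
    then have "res_sign r (\<lambda>i. ?v i + ?c ! i) = 0"
      by (rule res_sign_eq_0[OF p(1) q(1) p(3)])
    then show ?thesis
      using S False by simp
  qed
qed

section \<open>Coefficients of products of complete homogeneous symmetric functions\<close>

definition splittings :: "nat \<Rightarrow> (nat \<Rightarrow>\<^sub>0 nat) \<Rightarrow> (nat \<Rightarrow>\<^sub>0 nat) list set" where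
  "splittings r m = {as. length as = r \<and> sum_list as = m}"

lemma splittings_Suc:
  "splittings (Suc r) m = (\<lambda>((a, b), as). a # as) ` (SIGMA x:{(a, b). a + b = m}. splittings r (snd x))"
  by (force simp: splittings_def length_Suc_conv image_iff)

lemma finite_splittings: "finite (splittings r m)"
proof (induction r arbitrary: m)
  case 0
  then show ?case
    by (rule finite_subset[of _ "{[]}", rotated]) (auto simp: splittings_def)
next
  case (Suc r)
  then show ?case
    unfolding splittings_Suc by (intro finite_imageI finite_SigmaI finite_splits)
qed

text \<open>Every monomial of degree \<open>k\<close> has coefficient 1 in
  \<open>complete_hom k\<close>, so a coefficient of the product counts the factorisations of the
  monomial with prescribed degrees.\<close>

lemma coeff_at_complete_hom_prod:
  "coeff_at (complete_hom_prod w) m = of_nat (card {as \<in> splittings (length w) m. map mdeg as = w})"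
proof (induction w arbitrary: m)
  case Nil
  have "{as \<in> splittings 0 m. map mdeg as = []} = (if m = 0 then {[]} else {})"
    by (auto simp: splittings_def)
  then show ?case
    by (simp add: complete_hom_prod_def coeff_at_1)
next
  case (Cons k w)
  let ?T = "\<lambda>b. {as \<in> splittings (length w) b. map mdeg as = w}"
  let ?S = "{(a, b). a + b = m}"
  let ?X = "SIGMA x:{x \<in> ?S. mdeg (fst x) = k}. ?T (snd x)"
  have "{as \<in> splittings (length (k # w)) m. map mdeg as = k # w} = (\<lambda>((a, b), as). a # as) ` ?X"
    by (simp add: splittings_Suc) force
  moreover have "inj_on (\<lambda>((a, b), as). a # as) ?X"
    by (auto simp: inj_on_def)
  ultimately have "card {as \<in> splittings (length (k # w)) m. map mdeg as = k # w} = card ?X"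
    by (simp add: card_image)
  also have "\<dots> = (\<Sum>x | x \<in> ?S \<and> mdeg (fst x) = k. card (?T (snd x)))"
    by (rule card_SigmaI) (use finite_splits[of m] finite_splittings in auto)
  finally have "of_nat (card {as \<in> splittings (length (k # w)) m. map mdeg as = k # w}) =
      (\<Sum>x | x \<in> ?S \<and> mdeg (fst x) = k. of_nat (card (?T (snd x))) :: rat)"
    by simp
  also have "\<dots> = (\<Sum>x\<in>?S. if mdeg (fst x) = k then of_nat (card (?T (snd x))) else 0)"
    by (rule sum.inter_filter[OF finite_splits])
  also have "\<dots> = (\<Sum>(a, b) | a + b = m. coeff_at (complete_hom k) a * coeff_at (complete_hom_prod w) b)"
    by (rule sum.cong) (auto simp: Cons complete_hom.rep_eq)
  also have "\<dots> = coeff_at (complete_hom k * complete_hom_prod w) m"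
    by (rule coeff_at_mult[symmetric])
  finally show ?case
    by (simp add: complete_hom_prod_def)
qed

lemma mdeg_conv_sum:
  assumes "finite A" "Poly_Mapping.keys m \<subseteq> A"
  shows "mdeg m = (\<Sum>i\<in>A. Poly_Mapping.lookup m i)"
  unfolding mdeg_def using assms by (intro sum.mono_neutral_left) (auto simp: in_keys_iff)

lemma mdeg_add: "mdeg (a + b) = mdeg a + mdeg b"
proof -
  let ?A = "Poly_Mapping.keys a \<union> Poly_Mapping.keys b"
  have "mdeg (a + b) = (\<Sum>i\<in>?A. Poly_Mapping.lookup (a + b) i)"
    by (rule mdeg_conv_sum) (use keys_add[of a b] in auto)
  then show ?thesis
    by (simp add: lookup_add sum.distrib mdeg_conv_sum[of ?A a] mdeg_conv_sum[of ?A b])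
qed

lemma mdeg_single [simp]: "mdeg (Poly_Mapping.single v k) = k"
  by (subst mdeg_conv_sum[of "{v}"]) auto

lemma mdeg_0 [simp]: "mdeg 0 = 0"
  by (simp add: mdeg_def)

lemma mdeg_sum_list: "mdeg (sum_list as) = sum_list (map mdeg as)"
  by (induction as) (simp_all add: mdeg_add)

lemma lookup_sum_list:
  "Poly_Mapping.lookup (sum_list as) v = sum_list (map (\<lambda>a. Poly_Mapping.lookup a v) as)"
  by (induction as) (simp_all add: lookup_add)

section \<open>Splitting off one variable of the monomial\<close>

definition insert_var :: "nat \<Rightarrow> nat list \<Rightarrow> (nat \<Rightarrow>\<^sub>0 nat) list \<Rightarrow> (nat \<Rightarrow>\<^sub>0 nat) list" where
  "insert_var v c as = map2 (\<lambda>k a. Poly_Mapping.single v k + a) c as"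

lemma sum_list_insert_var:
  "length c = length as \<Longrightarrow> sum_list (insert_var v c as) = Poly_Mapping.single v (sum_list c) + sum_list as"
  unfolding insert_var_def
  by (induction c as rule: list_induct2) (simp_all add: single_add add_ac)

text \<open>As \<open>v\<close> does not occur in \<open>m\<close>, a splitting is determined by the
  exponents of \<open>v\<close> in its entries, a weak composition of \<open>e\<close>, and by what
  is left after deleting \<open>v\<close>, a splitting of \<open>m\<close>.\<close>

lemma sum_splittings_insert_var:
  fixes F :: "(nat \<Rightarrow>\<^sub>0 nat) list \<Rightarrow> 'a::comm_monoid_add"
  assumes v: "Poly_Mapping.lookup m v = 0"
  shows "(\<Sum>as\<in>splittings r (Poly_Mapping.single v e + m). F as)
    = (\<Sum>as\<in>splittings r m. \<Sum>c\<in>WCom r e. F (insert_var v c as))"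
proof -
  let ?del = "\<lambda>a. Poly_Mapping.update v 0 a :: nat \<Rightarrow>\<^sub>0 nat"
  let ?exp = "\<lambda>a. Poly_Mapping.lookup a v :: nat"
  have split: "Poly_Mapping.single v (?exp a) + ?del a = a" for a
    by (rule poly_mapping_eqI) (auto simp: lookup_add lookup_update lookup_single when_def)
  have del_add: "?del (a + b) = ?del a + ?del b" for a b
    by (rule poly_mapping_eqI) (auto simp: lookup_add lookup_update)
  have del_sum: "?del (sum_list as) = sum_list (map ?del as)" for as
    by (induction as) (auto simp: del_add intro!: poly_mapping_eqI simp: lookup_update)
  have del: "?del (Poly_Mapping.single v k + a) = a" if "?exp a = 0" for k a
    by (rule poly_mapping_eqI) (use that in \<open>auto simp: lookup_add lookup_update lookup_single when_def\<close>)
  have zero: "?exp a = 0" if "as \<in> splittings r m" "a \<in> set as" for a as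
    using that v lookup_sum_list[of as v] by (auto simp: splittings_def)
  have "(\<Sum>as\<in>splittings r (Poly_Mapping.single v e + m). F as)
      = (\<Sum>(as, c)\<in>splittings r m \<times> WCom r e. F (insert_var v c as))"
  proof (rule sum.reindex_bij_witness[where i = "\<lambda>(as, c). insert_var v c as"
        and j = "\<lambda>as. (map ?del as, map ?exp as)"], goal_cases)
    case (1 as)
    then show ?case
      by (auto simp: insert_var_def list_eq_iff_nth_eq split)
  next
    case (2 as)
    then have "length as = r" "sum_list as = Poly_Mapping.single v e + m"
      by (auto simp: splittings_def)
    then show ?case
      using del_sum[of as] lookup_sum_list[of as v] del[OF v, of e] v
      by (simp add: splittings_def WCom_def lookup_add)
  next
    case (3 x)
    obtain as c where x: "x = (as, c)"
      by (cases x)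
    with 3 have *: "as \<in> splittings r m" "length as = r" "length c = r"
      by (auto simp: splittings_def WCom_def)
    then have "?exp (as ! i) = 0" if "i < r" for i
      using zero that by auto
    then show ?case
      using x * by (auto simp: insert_var_def list_eq_iff_nth_eq del lookup_add)
  next
    case (4 x)
    then show ?case
      by (auto simp: splittings_def WCom_def sum_list_insert_var) (simp add: insert_var_def)
  next
    case (5 as)
    then show ?case
      by (auto simp: insert_var_def list_eq_iff_nth_eq split intro!: arg_cong[of _ _ F])
  qed
  then show ?thesis
    by (simp add: sum.cartesian_product)
qed

text \<open>Induction on the number of variables occurring in \<open>m\<close>: each variable
  contributes a factor 1 or 0 by \<open>sum_WCom_res_sign\<close>.\<close>

lemma sum_splittings_res_sign:
  assumes "r \<ge> 1"
  shows "(\<Sum>as\<in>splittings r m. res_sign r (\<lambda>i. u i + mdeg (as ! i)))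
    = (if \<forall>v. r dvd Poly_Mapping.lookup m v then res_sign r u else 0)"
proof (induction "card (Poly_Mapping.keys m)" arbitrary: m)
  case 0
  then have m: "m = 0"
    by simp
  have "splittings r m = {replicate r 0}"
  proof (intro equalityI subsetI)
    fix as assume "as \<in> splittings r m"
    then have as: "length as = r" "sum_list as = 0"
      by (auto simp: splittings_def m)
    then have "\<forall>a\<in>set as. \<forall>v. Poly_Mapping.lookup a v = 0"
      using lookup_sum_list[of as] by auto
    then show "as \<in> {replicate r 0}"
      using as by (auto intro!: replicate_eqI poly_mapping_eqI)
  qed (auto simp: splittings_def m sum_list_replicate)
  then have "(\<Sum>as\<in>splittings r m. res_sign r (\<lambda>i. u i + mdeg (as ! i))) = res_sign r (\<lambda>i. u i + mdeg (replicate r 0 ! i))"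
    by simp
  also have "\<dots> = res_sign r u"
    by (rule res_sign_cong) simp
  finally show ?case
    by (simp add: m)
next
  case (Suc d)
  then obtain v where v: "v \<in> Poly_Mapping.keys m"
    by fastforce
  define e where "e = Poly_Mapping.lookup m v"
  define m' where "m' = Poly_Mapping.update v 0 m"
  have lm': "Poly_Mapping.lookup m' x = (if x = v then 0 else Poly_Mapping.lookup m x)" for x
    by (simp add: m'_def lookup_update)
  have m: "m = Poly_Mapping.single v e + m'"
    by (rule poly_mapping_eqI) (auto simp: lm' e_def lookup_add lookup_single when_def)
  have "Poly_Mapping.keys m' = Poly_Mapping.keys m - {v}"
    by (auto simp: in_keys_iff lm' split: if_splits)
  then have card: "d = card (Poly_Mapping.keys m')"
    using Suc.hyps(2) v by (simp add: card_Diff_singleton)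
  have "(\<Sum>as\<in>splittings r m. res_sign r (\<lambda>i. u i + mdeg (as ! i)))
      = (\<Sum>as\<in>splittings r m'. \<Sum>c\<in>WCom r e. res_sign r (\<lambda>i. u i + mdeg (insert_var v c as ! i)))"
    unfolding m by (rule sum_splittings_insert_var) (simp add: lm')
  \<comment> \<open>For a fixed splitting of \<open>m'\<close>, the inner sum has starting vector
    \<open>u i + mdeg (as ! i)\<close>, and the exponents of \<open>v\<close> are the steps.\<close>
  also have "\<dots> = (\<Sum>as\<in>splittings r m'. \<Sum>c\<in>WCom r e. res_sign r (\<lambda>i. (u i + mdeg (as ! i)) + c ! i))"
    by (intro sum.cong refl res_sign_cong)
      (auto simp: splittings_def WCom_def insert_var_def mdeg_add add_ac)
  also have "\<dots> = (\<Sum>as\<in>splittings r m'. if r dvd e then res_sign r (\<lambda>i. u i + mdeg (as ! i)) else 0)"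
    by (simp only: sum_WCom_res_sign[OF assms])
  also have "\<dots> = (if r dvd e then if \<forall>v. r dvd Poly_Mapping.lookup m' v then res_sign r u else 0 else 0)"
    using Suc.hyps(1)[OF card] by simp
  also have "\<dots> = (if \<forall>v. r dvd Poly_Mapping.lookup m v then res_sign r u else 0)"
  proof -
    have "(r dvd e \<and> (\<forall>x. r dvd Poly_Mapping.lookup m' x)) \<longleftrightarrow> (\<forall>x. r dvd Poly_Mapping.lookup m x)"
      by (auto simp: lm' e_def)
    then show ?thesis
      by auto
  qed
  finally show ?case .
qed

section \<open>Comparison of coefficients\<close>

lemma coeff_at_sum: "coeff_at (sum f A) m = (\<Sum>x\<in>A. coeff_at (f x) m)"
  by (induction A rule: infinite_finite_induct) simp_all

lemma coeff_at_of_int_mult: "coeff_at (of_int z * f) m = of_int z * coeff_at f m"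
proof -
  have nat: "coeff_at (of_nat k * f) m = of_nat k * coeff_at f m" for k
    by (induction k) (simp_all add: distrib_right)
  show ?thesis
    by (cases z rule: int_cases2) (simp_all add: nat uminus_series.rep_eq)
qed

lemma mdeg_map_div:
  assumes "\<forall>v. r dvd Poly_Mapping.lookup m v"
  shows "mdeg m = mdeg (Poly_Mapping.map (\<lambda>e. e div r) m) * r"
proof -
  have "mdeg (Poly_Mapping.map (\<lambda>e. e div r) m) =
      (\<Sum>i\<in>Poly_Mapping.keys m. Poly_Mapping.lookup (Poly_Mapping.map (\<lambda>e. e div r) m) i)"
    by (rule mdeg_conv_sum) (simp, metis div_0 in_keys_iff lookup_map_div subsetI)
  then show ?thesis
    using assms by (simp add: mdeg_def lookup_map_div sum_distrib_right)
qed

theorem theorem50: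
  fixes n r :: nat
  assumes "n \<ge> 1" and "r \<ge> 1"
  shows "plethysm_power_sum (complete_hom n) r =
    (\<Sum>w\<in>WCom r (n * r). of_int (s_hat r w) * complete_hom_prod w)"
proof (rule series_eqI)
  fix m :: "nat \<Rightarrow>\<^sub>0 nat"
  let ?D = "\<forall>v. r dvd Poly_Mapping.lookup m v"
  let ?W = "WCom r (n * r)"
  let ?S = "{as \<in> splittings r m. map mdeg as \<in> ?W}"
  \<comment> \<open>Degrees add up along a splitting, so either all splittings of \<open>m\<close>
    have their degree vector in \<open>?W\<close> or none has.\<close>
  have deg: "map mdeg as \<in> ?W \<longleftrightarrow> mdeg m = n * r" if "as \<in> splittings r m" for as
    using that by (auto simp: splittings_def WCom_def mdeg_sum_list)
  have "coeff_at (\<Sum>w\<in>?W. of_int (s_hat r w) * complete_hom_prod w) m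
      = (\<Sum>w\<in>?W. of_int (s_hat r w) * of_nat (card {as \<in> splittings r m. map mdeg as = w}))"
    unfolding coeff_at_sum coeff_at_of_int_mult coeff_at_complete_hom_prod
    by (rule sum.cong) (auto simp: WCom_def)
  \<comment> \<open>The cardinality becomes a sum over the splittings with degree vector
    \<open>w\<close>, where the sign is constant; these fibres are then merged by
    \<open>sum.group\<close>.\<close>
  also have "\<dots> = of_int (\<Sum>w\<in>?W. \<Sum>as | as \<in> ?S \<and> map mdeg as = w. s_hat r (map mdeg as))"
    unfolding of_int_sum
    by (rule sum.cong[OF refl]) (auto simp: mult.commute intro!: arg_cong[of _ _ card])
  also have "\<dots> = of_int (\<Sum>as\<in>?S. s_hat r (map mdeg as))"
    by (subst sum.group) (use finite_splittings finite_WCom in auto)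
  also have "\<dots> = of_int (if mdeg m = n * r then \<Sum>as\<in>splittings r m. s_hat r (map mdeg as) else 0)"
  proof (cases "mdeg m = n * r")
    case True
    then have "?S = splittings r m"
      using deg by auto
    with True show ?thesis by simp
  next
    case False
    then have S: "?S = {}"
      using deg by auto
    show ?thesis
      unfolding S using False by simp
  qed
  also have "(\<Sum>as\<in>splittings r m. s_hat r (map mdeg as)) = (if ?D then 1 else 0)"
  proof -
    \<comment> \<open>The starting vector is \<open>(0, ..., r - 1)\<close>, whose residues
      increase, so its sign is 1.\<close>
    have "(\<Sum>as\<in>splittings r m. s_hat r (map mdeg as))
        = (\<Sum>as\<in>splittings r m. res_sign r (\<lambda>i. i + mdeg (as ! i)))"
      unfolding s_hat_eq_res_sign
      by (intro sum.cong refl res_sign_cong) (auto simp: splittings_def add_ac)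
    then show ?thesis
      using sum_splittings_res_sign[OF assms(2), of "\<lambda>i. i" m] by (simp add: res_sign_id)
  qed
  \<comment> \<open>When \<open>r\<close> divides all exponents, the divided monomial has degree
    \<open>n\<close> exactly if \<open>mdeg m = n * r\<close>, since \<open>r\<close> is
    positive.\<close>
  also have "of_int (if mdeg m = n * r then if ?D then 1 else 0 else 0) =
      coeff_at (plethysm_power_sum (complete_hom n) r) m"
    using mdeg_map_div[of r m] assms by (auto simp: plethysm_power_sum.rep_eq complete_hom.rep_eq)
  finally show "coeff_at (plethysm_power_sum (complete_hom n) r) m =
      coeff_at (\<Sum>w\<in>?W. of_int (s_hat r w) * complete_hom_prod w) m"
    by (rule sym)
qed

end
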